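(* Let $\Sigma$ be a finite alphabet. Every language $L \subseteq \Sigma^*$ that is recognizable by a fixed-precision transformer classifier is definable by a sentence of $\mathsf{FOC}[+;\mathsf{MOD}]$.
   Context: **The logic $\mathsf{FOC}[+;\mathsf{MOD}]$.** Fix a finite alphabet $\Sigma$. Formulas are interpreted in finite strings $w=w_1\cdots w_n\in\Sigma^*$. There are two sorts. Position variables $p,q,\dots$ range over integers in $[1,n]$. Count variables $x,y,z,\dots$ range over the rational numbers; count terms are $c_0+c_1x_1+\dots+c_kx_k$ with rational constants $c_i$ and count variables $x_i$. Formulas are: $\top$ (true), $\bot$ (false); $Q_a(p)$ for $a\in\Sigma$, true iff $w_p=a$; $\mathsf{MOD}^r_m(p)$ for integers $r\ge0$, $m>0$, true iff $p\equiv r \pmod m$; $t_1=t_2$ and $t_1<t_2$ for count terms $t_1,t_2$; $\phi_1\land\phi_2$, $\phi_1\lor\phi_2$, $\neg\phi_1$; $\exists x.\phi$ and $\forall x.\phi$ for a count variable $x$ (quantifying over the rationals); and $\exists^{=x}p.\phi$ for a count variable $x$ and position variable $p$, true iff $\phi$ is true for exactly $x$ values of $p\in[1,n]$ (this binds $p$ but leaves $x$ free). A sentence is a formula with no free variables. The language defined by a sentence $\sigma$ is $\{w\in\Sigma^*\mid w\models\sigma\}$. **Transformer classifiers (exact version).** Let $\mathrm{CLS}\notin\Sigma$ be a special symbol. For $w=w_1\cdots w_n\in\Sigma^*$ put $n'=n+1$ and $w_0=\mathrm{CLS}$; matrices in $\mathbb R^{d\times n'}$ have rows indexed $1,\dots,d$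 and columns indexed $0,\dots,n$; $A_{*,p}$ is column $p$ of $A$. A word embedding of width $d$ is a map $\mathrm{WE}\colon\Sigma\cup\{\mathrm{CLS}\}\to\mathbb R^d$. A sinusoidal positional encoding of even width $d$ is $\mathrm{PE}(p)=(\sin 2\pi\xi_1p,\cos 2\pi\xi_1p,\dots,\sin2\pi\xi_{d/2}p,\cos2\pi\xi_{d/2}p)^\top$ with $\xi_i\in\mathbb Q$. A self-attention $\mathrm{SA}$ of width $d$ and key width $d_K$ has parameters $W^{(Q)},W^{(K)}\in\mathbb R^{d_K\times d}$, $W^{(V)}\in\mathbb R^{d\times d}$ and maps $A\in\mathbb R^{d\times n'}$ to $[c_0\ \cdots\ c_n]$ where $s_{qp}=\frac{W^{(Q)}A_{*,q}\cdot W^{(K)}A_{*,p}}{\sqrt d}$ and $c_q=\frac{\sum_{p=0}^n(\exp s_{qp})W^{(V)}A_{*,p}}{\sum_{p=0}^n\exp s_{qp}}$. A position-wise feed-forward network (FFN) of width $d$ and hidden width $d_{FF}$ is $\mathrm{FF}(x)=W^{(2)}\max(0,W^{(1)}x+b^{(1)})+b^{(2)}$ (max elementwise) with $W^{(1)}\in\mathbb R^{d_{FF}\times d}$, $b^{(1)}\in\mathbb R^{d_{FF}}$, $W^{(2)}\in\mathbb R^{d\times d_{FF}}$, $b^{(2)}\in\mathbb R^d$, applied to matrices columnwise. A transformer layer with $H$ heads maps $A$ to $A''=\mathrm{FF}(A')+A'$ where $A'=\sum_{h=1}^H\mathrm{SA}^{(h)}(A)+A$. A transformer stack of width $d$ is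 a composition of $L\ge0$ layers of width $d$. A transformer encoder of width $d$ maps $w$ to $\mathrm{Enc}(w)=\mathrm{Stack}(A)\in\mathbb R^{d\times n'}$ where $A_{*,p}=\mathrm{WE}(w_p)+\mathrm{PE}(p)$, $0\le p\le n$. A transformer classifier is $\mathrm{Cls}(w)=\mathrm{sigmoid}(W[\mathrm{Enc}(w)]_{*,0}+b)$ with $W\in\mathbb R^{1\times d}$, $b\in\mathbb R$; it accepts $w$ iff $\mathrm{Cls}(w)\ge\frac12$, and recognizes the language $\{w\in\Sigma^*\mid \mathrm{Cls}\text{ accepts }w\}$. All parameters (including the number of layers, heads, widths) are fixed independently of $n$. **Fixed precision.** For fixed natural numbers $r,s$ let $\mathbb F=\mathbb F_{r,s}=\{i/2^s\mid i\in\mathbb Z,\ -2^{r+s}\le i<2^{r+s}\}$. A fixed-precision transformer classifier is a transformer classifier in which, for some fixed $r,s$, all parameters and all computed values lie in $\mathbb F$, computed as follows. The components of the positional encoding are rounded to the nearest element of $\mathbb F$. The attention output is computed in the form $c_q=\frac{\frac1{n'}\sum_p(\exp s_{qp})W^{(V)}A_{*,p}}{\frac1{n'}\sum_p\exp s_{qp}}$, where each average over positions $\frac1{n'}\sum_{p=0}^n(\cdot)$ of values in $\mathbb F$ is computed exactly and then rounded to an element of $\mathbb F$ by a fixed rounding mode (down, up, or to nearest). Every other scalar operation (addition, multiplication, division, $\exp$, ReLU, sigmoid, scaling by $1/\sqrt d$, etc.) is replaced by an arbitrary fixed function $\mathbb F\to\mathbb F$ or $\mathbb F\times\mathbb F\to\mathbb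 F$ (so any rounding scheme is allowed for them), with a fixed order of evaluation not depending on $w$. *)

theory Defs
  imports Complex_Main "HOL-Library.FuncSet"
begin

section \<open>The logic FOC[+;MOD]\<close>

text \<open>Position variables and count variables are both named by natural numbers, in two
  separate name spaces. \<open>CTerm c\<^sub>0 [(c\<^sub>1, x\<^sub>1), \<dots>]\<close> is the term \<open>c\<^sub>0 + c\<^sub>1 x\<^sub>1 + \<dots>\<close>.\<close>

datatype cterm = CTerm rat "(rat \<times> nat) list"

datatype 'a foc =
    Tru
  | Fls
  | Letter 'a nat            \<comment> \<open>\<open>Q\<^sub>a(p)\<close>\<close>
  | Mod nat nat nat          \<comment> \<open>\<open>Mod r m p\<close>: \<open>p\<close> is congruent to \<open>r\<close> modulo \<open>m\<close>\<close>
  | CEq cterm cterm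
  | CLess cterm cterm
  | Conj "'a foc" "'a foc"
  | Disj "'a foc" "'a foc"
  | Neg "'a foc"
  | ExC nat "'a foc"
  | AllC nat "'a foc"
  | ExCount nat nat "'a foc" \<comment> \<open>\<open>ExCount x p \<phi>\<close>: exactly \<open>x\<close> positions \<open>p\<close> satisfy \<open>\<phi>\<close>\<close>

fun cterm_val :: "(nat \<Rightarrow> rat) \<Rightarrow> cterm \<Rightarrow> rat" where
  "cterm_val \<beta> (CTerm c cs) = c + (\<Sum>(a, x)\<leftarrow>cs. a * \<beta> x)"

fun sat :: "'a list \<Rightarrow> (nat \<Rightarrow> nat) \<Rightarrow> (nat \<Rightarrow> rat) \<Rightarrow> 'a foc \<Rightarrow> bool" where
  "sat w \<alpha> \<beta> Tru \<longleftrightarrow> True"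
| "sat w \<alpha> \<beta> Fls \<longleftrightarrow> False"
| "sat w \<alpha> \<beta> (Letter a p) \<longleftrightarrow> w ! (\<alpha> p - 1) = a"
| "sat w \<alpha> \<beta> (Mod r m p) \<longleftrightarrow> \<alpha> p mod m = r mod m"
| "sat w \<alpha> \<beta> (CEq t u) \<longleftrightarrow> cterm_val \<beta> t = cterm_val \<beta> u"
| "sat w \<alpha> \<beta> (CLess t u) \<longleftrightarrow> cterm_val \<beta> t < cterm_val \<beta> u"
| "sat w \<alpha> \<beta> (Conj \<phi> \<psi>) \<longleftrightarrow> sat w \<alpha> \<beta> \<phi> \<and> sat w \<alpha> \<beta> \<psi>"
| "sat w \<alpha> \<beta> (Disj \<phi> \<psi>) \<longleftrightarrow> sat w \<alpha> \<beta> \<phi> \<or> sat w \<alpha> \<beta> \<psi>"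
| "sat w \<alpha> \<beta> (Neg \<phi>) \<longleftrightarrow> \<not> sat w \<alpha> \<beta> \<phi>"
| "sat w \<alpha> \<beta> (ExC x \<phi>) \<longleftrightarrow> (\<exists>c. sat w \<alpha> (\<beta>(x := c)) \<phi>)"
| "sat w \<alpha> \<beta> (AllC x \<phi>) \<longleftrightarrow> (\<forall>c. sat w \<alpha> (\<beta>(x := c)) \<phi>)"
| "sat w \<alpha> \<beta> (ExCount x p \<phi>) \<longleftrightarrow>
     of_nat (card {i \<in> {1..length w}. sat w (\<alpha>(p := i)) \<beta> \<phi>}) = \<beta> x"

fun cterm_vars :: "cterm \<Rightarrow> nat set" where
  "cterm_vars (CTerm c cs) = snd ` set cs"

fun free_pos :: "'a foc \<Rightarrow> nat set" where
  "free_pos Tru = {}"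
| "free_pos Fls = {}"
| "free_pos (Letter a p) = {p}"
| "free_pos (Mod r m p) = {p}"
| "free_pos (CEq t u) = {}"
| "free_pos (CLess t u) = {}"
| "free_pos (Conj \<phi> \<psi>) = free_pos \<phi> \<union> free_pos \<psi>"
| "free_pos (Disj \<phi> \<psi>) = free_pos \<phi> \<union> free_pos \<psi>"
| "free_pos (Neg \<phi>) = free_pos \<phi>"
| "free_pos (ExC x \<phi>) = free_pos \<phi>"
| "free_pos (AllC x \<phi>) = free_pos \<phi>"
| "free_pos (ExCount x p \<phi>) = free_pos \<phi> - {p}"

fun free_count :: "'a foc \<Rightarrow> nat set" where
  "free_count Tru = {}"
| "free_count Fls = {}"
| "free_count (Letter a p) = {}"
| "free_count (Mod r m p) = {}"
| "free_count (CEq t u) = cterm_vars t \<union> cterm_vars u"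
| "free_count (CLess t u) = cterm_vars t \<union> cterm_vars u"
| "free_count (Conj \<phi> \<psi>) = free_count \<phi> \<union> free_count \<psi>"
| "free_count (Disj \<phi> \<psi>) = free_count \<phi> \<union> free_count \<psi>"
| "free_count (Neg \<phi>) = free_count \<phi>"
| "free_count (ExC x \<phi>) = free_count \<phi> - {x}"
| "free_count (AllC x \<phi>) = free_count \<phi> - {x}"
| "free_count (ExCount x p \<phi>) = insert x (free_count \<phi>)"

text \<open>A modulus 0 has to be excluded explicitly: since \<open>p mod 0 = p\<close>, it would express
  \<open>p = r\<close>.\<close>

fun moduli_pos :: "'a foc \<Rightarrow> bool" where
  "moduli_pos (Mod r m p) \<longleftrightarrow> m > 0"
| "moduli_pos (Conj \<phi> \<psi>) \<longleftrightarrow> moduli_pos \<phi> \<and> moduli_pos \<psi>"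
| "moduli_pos (Disj \<phi> \<psi>) \<longleftrightarrow> moduli_pos \<phi> \<and> moduli_pos \<psi>"
| "moduli_pos (Neg \<phi>) \<longleftrightarrow> moduli_pos \<phi>"
| "moduli_pos (ExC x \<phi>) \<longleftrightarrow> moduli_pos \<phi>"
| "moduli_pos (AllC x \<phi>) \<longleftrightarrow> moduli_pos \<phi>"
| "moduli_pos (ExCount x p \<phi>) \<longleftrightarrow> moduli_pos \<phi>"
| "moduli_pos _ \<longleftrightarrow> True"

definition sentence :: "'a foc \<Rightarrow> bool" where
  "sentence \<sigma> \<longleftrightarrow> moduli_pos \<sigma> \<and> free_pos \<sigma> = {} \<and> free_count \<sigma> = {}"

lemma sat_cong:
  assumes "\<And>p. p \<in> free_pos \<phi> \<Longrightarrow> \<alpha> p = \<alpha>' p"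
    and "\<And>x. x \<in> free_count \<phi> \<Longrightarrow> \<beta> x = \<beta>' x"
  shows "sat w \<alpha> \<beta> \<phi> \<longleftrightarrow> sat w \<alpha>' \<beta>' \<phi>"
proof -
  have val: "cterm_val \<beta> t = cterm_val \<beta>' t"
    if "\<And>x. x \<in> cterm_vars t \<Longrightarrow> \<beta> x = \<beta>' x" for t and \<beta> \<beta>' :: "nat \<Rightarrow> rat"
    using that by (cases t) (force intro: arg_cong[where f = sum_list] map_cong)
  show ?thesis
    using assms
  proof (induction \<phi> arbitrary: \<alpha> \<alpha>' \<beta> \<beta>')
    case (CEq t u)
    then show ?case using val[of t \<beta> \<beta>'] val[of u \<beta> \<beta>'] by simp
  next
    case (CLess t u)
    then show ?case using val[of t \<beta> \<beta>'] val[of u \<beta> \<beta>'] by simp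
  next
    case (Conj \<phi> \<psi>)
    have "sat w \<alpha> \<beta> \<phi> = sat w \<alpha>' \<beta>' \<phi>" "sat w \<alpha> \<beta> \<psi> = sat w \<alpha>' \<beta>' \<psi>"
      using Conj.prems by (auto intro!: Conj.IH)
    then show ?case by simp
  next
    case (Disj \<phi> \<psi>)
    have "sat w \<alpha> \<beta> \<phi> = sat w \<alpha>' \<beta>' \<phi>" "sat w \<alpha> \<beta> \<psi> = sat w \<alpha>' \<beta>' \<psi>"
      using Disj.prems by (auto intro!: Disj.IH)
    then show ?case by simp
  next
    case (Neg \<phi>)
    have "sat w \<alpha> \<beta> \<phi> = sat w \<alpha>' \<beta>' \<phi>"
      using Neg.prems by (auto intro!: Neg.IH)
    then show ?case by simp
  next
    case (ExC x \<phi>)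
    have "sat w \<alpha> (\<beta>(x := c)) \<phi> = sat w \<alpha>' (\<beta>'(x := c)) \<phi>" for c
      using ExC.prems by (intro ExC.IH) auto
    then show ?case by simp
  next
    case (AllC x \<phi>)
    have "sat w \<alpha> (\<beta>(x := c)) \<phi> = sat w \<alpha>' (\<beta>'(x := c)) \<phi>" for c
      using AllC.prems by (intro AllC.IH) auto
    then show ?case by simp
  next
    case (ExCount x p \<phi>)
    have "sat w (\<alpha>(p := i)) \<beta> \<phi> = sat w (\<alpha>'(p := i)) \<beta>' \<phi>" for i
      using ExCount.prems by (intro ExCount.IH) auto
    moreover have "\<beta> x = \<beta>' x"
      using ExCount.prems by simp
    ultimately show ?case by simp
  qed auto
qed

text \<open>By \<open>sat_cong\<close>, the assignments are irrelevant to the truth of a sentence. They are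
  deliberately not restricted to positions of \<open>w\<close>, as no such assignment exists for the
  empty string.\<close>

definition foc_language :: "'a foc \<Rightarrow> 'a list set" where
  "foc_language \<sigma> = {w. \<forall>\<alpha> \<beta>. sat w \<alpha> \<beta> \<sigma>}"

definition foc_definable :: "'a list set \<Rightarrow> bool" where
  "foc_definable L \<longleftrightarrow> (\<exists>\<sigma>. sentence \<sigma> \<and> foc_language \<sigma> = L)"


section \<open>Fixed-precision arithmetic\<close>

definition fixed_points :: "nat \<Rightarrow> nat \<Rightarrow> real set" where
  "fixed_points r s =
     {real_of_int i / 2 ^ s |i. - (2 ^ (r + s)) \<le> i \<and> i < 2 ^ (r + s)}"

text \<open>Rounding functions. Rounding to nearest may break ties in any way. Rounding down and
  up only matter, and in general only make sense, between the extreme elements of \<open>F\<close>;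
  averages of elements of \<open>F\<close> always lie there.\<close>

definition rounds_down :: "real set \<Rightarrow> (real \<Rightarrow> real) \<Rightarrow> bool" where
  "rounds_down F f \<longleftrightarrow>
     (\<forall>x\<in>{Min F..Max F}. f x \<in> F \<and> f x \<le> x \<and> (\<forall>y\<in>F. y \<le> x \<longrightarrow> y \<le> f x))"

definition rounds_up :: "real set \<Rightarrow> (real \<Rightarrow> real) \<Rightarrow> bool" where
  "rounds_up F f \<longleftrightarrow>
     (\<forall>x\<in>{Min F..Max F}. f x \<in> F \<and> x \<le> f x \<and> (\<forall>y\<in>F. x \<le> y \<longrightarrow> f x \<le> y))"

definition rounds_nearest :: "real set \<Rightarrow> (real \<Rightarrow> real) \<Rightarrow> bool" where
  "rounds_nearest F f \<longleftrightarrow> (\<forall>x. f x \<in> F \<and> (\<forall>y\<in>F. \<bar>x - f x\<bar> \<le> \<bar>x - y\<bar>))"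

text \<open>The scalar operations. \<open>op_scale\<close> stands for scaling by \<open>1 / sqrt d\<close>, which is unary
  because the width \<open>d\<close> is fixed; \<open>avg_round\<close> rounds averages over positions and
  \<open>pe_round\<close> rounds the components of the positional encoding.\<close>

record arith =
  op_add :: "real \<Rightarrow> real \<Rightarrow> real"
  op_mult :: "real \<Rightarrow> real \<Rightarrow> real"
  op_div :: "real \<Rightarrow> real \<Rightarrow> real"
  op_exp :: "real \<Rightarrow> real"
  op_relu :: "real \<Rightarrow> real"
  op_sigmoid :: "real \<Rightarrow> real"
  op_scale :: "real \<Rightarrow> real"
  avg_round :: "real \<Rightarrow> real"
  pe_round :: "real \<Rightarrow> real"

definition fp_arith :: "real set \<Rightarrow> arith \<Rightarrow> bool" where
  "fp_arith F ar \<longleftrightarrow>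
     op_add ar \<in> F \<rightarrow> F \<rightarrow> F \<and> op_mult ar \<in> F \<rightarrow> F \<rightarrow> F \<and> op_div ar \<in> F \<rightarrow> F \<rightarrow> F \<and>
     op_exp ar \<in> F \<rightarrow> F \<and> op_relu ar \<in> F \<rightarrow> F \<and> op_sigmoid ar \<in> F \<rightarrow> F \<and>
     op_scale ar \<in> F \<rightarrow> F \<and>
     (rounds_down F (avg_round ar) \<or> rounds_up F (avg_round ar) \<or>
      rounds_nearest F (avg_round ar)) \<and>
     rounds_nearest F (pe_round ar)"

text \<open>Rounded addition need not be associative or commutative, so every sum carries its
  order of evaluation: a binary tree in which each of the \<open>k\<close> summands occurs exactly once.
  \<open>Zero\<close> covers empty sums and accumulators initialised to 0.\<close>

datatype sum_order = Zero | Term nat | Plus sum_order sum_order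

fun summands :: "sum_order \<Rightarrow> nat list" where
  "summands Zero = []"
| "summands (Term j) = [j]"
| "summands (Plus t u) = summands t @ summands u"

definition orders :: "sum_order \<Rightarrow> nat \<Rightarrow> bool" where
  "orders t k \<longleftrightarrow> distinct (summands t) \<and> set (summands t) = {..<k}"

fun fp_sum :: "arith \<Rightarrow> sum_order \<Rightarrow> (nat \<Rightarrow> real) \<Rightarrow> real" where
  "fp_sum ar Zero f = 0"
| "fp_sum ar (Term j) f = f j"
| "fp_sum ar (Plus t u) f = op_add ar (fp_sum ar t f) (fp_sum ar u f)"

definition fp_average :: "arith \<Rightarrow> nat \<Rightarrow> (nat \<Rightarrow> real) \<Rightarrow> real" where
  "fp_average ar n f = avg_round ar ((\<Sum>p=0..n. f p) / real (n + 1))"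


section \<open>Fixed-precision transformer classifiers\<close>

text \<open>Vectors and matrices are functions on 0-based indices, of which only the values within
  the dimensions given by the validity predicates are used. A sequence of
  activation vectors \<open>A\<close> is indexed by positions first: \<open>A p i\<close> is the entry in row \<open>i\<close>,
  column \<open>p\<close>. For a string of length \<open>n\<close> the positions are \<open>0, \<dots>, n\<close>, with CLS at 0.\<close>

record linear =
  weight :: "nat \<Rightarrow> nat \<Rightarrow> real"
  row_order :: "nat \<Rightarrow> sum_order"

definition fp_linear :: "real set \<Rightarrow> nat \<Rightarrow> nat \<Rightarrow> linear \<Rightarrow> bool" where
  "fp_linear F m n M \<longleftrightarrow>
     (\<forall>i<m. (\<forall>j<n. weight M i j \<in> F) \<and> orders (row_order M i) n)"

definition linear_app :: "arith \<Rightarrow> linear \<Rightarrow> (nat \<Rightarrow> real) \<Rightarrow> nat \<Rightarrow> real" where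
  "linear_app ar M v i = fp_sum ar (row_order M i) (\<lambda>j. op_mult ar (weight M i j) (v j))"

text \<open>In an affine map, summand 0 of each row is the bias.\<close>

record affine = linear + bias :: "nat \<Rightarrow> real"

definition fp_affine :: "real set \<Rightarrow> nat \<Rightarrow> nat \<Rightarrow> affine \<Rightarrow> bool" where
  "fp_affine F m n M \<longleftrightarrow>
     (\<forall>i<m. (\<forall>j<n. weight M i j \<in> F) \<and> bias M i \<in> F \<and> orders (row_order M i) (Suc n))"

definition affine_app :: "arith \<Rightarrow> affine \<Rightarrow> (nat \<Rightarrow> real) \<Rightarrow> nat \<Rightarrow> real" where
  "affine_app ar M v i = fp_sum ar (row_order M i)
     (\<lambda>k. case k of 0 \<Rightarrow> bias M i | Suc j \<Rightarrow> op_mult ar (weight M i j) (v j))"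

record head =
  key_width :: nat
  WQ :: linear
  WK :: linear
  WV :: linear
  score_order :: sum_order

definition fp_head :: "real set \<Rightarrow> nat \<Rightarrow> head \<Rightarrow> bool" where
  "fp_head F d h \<longleftrightarrow>
     fp_linear F (key_width h) d (WQ h) \<and> fp_linear F (key_width h) d (WK h) \<and>
     fp_linear F d d (WV h) \<and> orders (score_order h) (key_width h)"

definition score :: "arith \<Rightarrow> head \<Rightarrow> (nat \<Rightarrow> nat \<Rightarrow> real) \<Rightarrow> nat \<Rightarrow> nat \<Rightarrow> real" where
  "score ar h A q p = op_scale ar (fp_sum ar (score_order h)
     (\<lambda>i. op_mult ar (linear_app ar (WQ h) (A q) i) (linear_app ar (WK h) (A p) i)))"

definition attention ::
    "arith \<Rightarrow> nat \<Rightarrow> head \<Rightarrow> (nat \<Rightarrow> nat \<Rightarrow> real) \<Rightarrow> nat \<Rightarrow> nat \<Rightarrow> real" where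
  "attention ar n h A q i = op_div ar
     (fp_average ar n
        (\<lambda>p. op_mult ar (op_exp ar (score ar h A q p)) (linear_app ar (WV h) (A p) i)))
     (fp_average ar n (\<lambda>p. op_exp ar (score ar h A q p)))"

text \<open>In the sum of the heads and the residual connection, summand 0 is the residual.\<close>

record layer =
  heads :: "head list"
  heads_order :: "nat \<Rightarrow> sum_order"
  hidden_width :: nat
  ff1 :: affine
  ff2 :: affine

definition fp_layer :: "real set \<Rightarrow> nat \<Rightarrow> layer \<Rightarrow> bool" where
  "fp_layer F d l \<longleftrightarrow>
     (\<forall>h\<in>set (heads l). fp_head F d h) \<and>
     (\<forall>i<d. orders (heads_order l i) (Suc (length (heads l)))) \<and>
     fp_affine F (hidden_width l) d (ff1 l) \<and> fp_affine F d (hidden_width l) (ff2 l)"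

definition heads_app ::
    "arith \<Rightarrow> nat \<Rightarrow> layer \<Rightarrow> (nat \<Rightarrow> nat \<Rightarrow> real) \<Rightarrow> nat \<Rightarrow> nat \<Rightarrow> real" where
  "heads_app ar n l A q i = fp_sum ar (heads_order l i)
     (\<lambda>k. case k of 0 \<Rightarrow> A q i | Suc h \<Rightarrow> attention ar n (heads l ! h) A q i)"

definition ff_app :: "arith \<Rightarrow> layer \<Rightarrow> (nat \<Rightarrow> real) \<Rightarrow> nat \<Rightarrow> real" where
  "ff_app ar l v = affine_app ar (ff2 l) (\<lambda>k. op_relu ar (affine_app ar (ff1 l) v k))"

definition layer_app ::
    "arith \<Rightarrow> nat \<Rightarrow> layer \<Rightarrow> (nat \<Rightarrow> nat \<Rightarrow> real) \<Rightarrow> nat \<Rightarrow> nat \<Rightarrow> real" where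
  "layer_app ar n l A =
     (let A' = heads_app ar n l A in (\<lambda>q i. op_add ar (ff_app ar l (A' q) i) (A' q i)))"

text \<open>The symbol CLS is \<^const>\<open>None\<close>. The frequencies are arbitrary rationals; only the
  resulting components of the positional encoding are rounded to \<open>F\<close>.\<close>

record 'a classifier =
  width :: nat
  word_emb :: "'a option \<Rightarrow> nat \<Rightarrow> real"
  freq :: "nat \<Rightarrow> rat"
  layers :: "layer list"
  out :: affine

definition fp_classifier :: "real set \<Rightarrow> 'a classifier \<Rightarrow> bool" where
  "fp_classifier F T \<longleftrightarrow>
     even (width T) \<and> width T > 0 \<and>
     (\<forall>a. \<forall>i<width T. word_emb T a i \<in> F) \<and>
     (\<forall>l\<in>set (layers T). fp_layer F (width T) l) \<and>
     fp_affine F 1 (width T) (out T)"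

definition pos_enc :: "(nat \<Rightarrow> rat) \<Rightarrow> nat \<Rightarrow> nat \<Rightarrow> real" where
  "pos_enc \<xi> p i =
     (let x = 2 * pi * of_rat (\<xi> (i div 2)) * real p in if even i then sin x else cos x)"

definition embed :: "arith \<Rightarrow> 'a classifier \<Rightarrow> 'a list \<Rightarrow> nat \<Rightarrow> nat \<Rightarrow> real" where
  "embed ar T w p i =
     op_add ar (word_emb T (if p = 0 then None else Some (w ! (p - 1))) i)
       (pe_round ar (pos_enc (freq T) p i))"

definition encode :: "arith \<Rightarrow> 'a classifier \<Rightarrow> 'a list \<Rightarrow> nat \<Rightarrow> nat \<Rightarrow> real" where
  "encode ar T w = fold (layer_app ar (length w)) (layers T) (embed ar T w)"

definition classify :: "arith \<Rightarrow> 'a classifier \<Rightarrow> 'a list \<Rightarrow> real" where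
  "classify ar T w = op_sigmoid ar (affine_app ar (out T) (encode ar T w 0) 0)"

definition recognized_language :: "arith \<Rightarrow> 'a classifier \<Rightarrow> 'a list set" where
  "recognized_language ar T = {w. classify ar T w \<ge> 1 / 2}"

definition fp_recognizable :: "'a list set \<Rightarrow> bool" where
  "fp_recognizable L \<longleftrightarrow>
     (\<exists>r s ar T. fp_arith (fixed_points r s) ar \<and> fp_classifier (fixed_points r s) T \<and>
        recognized_language ar T = L)"

end

theory Submission
  imports Defs
begin

text \<open>Every activation takes values in the finite set \<open>F\<close>, so it suffices to define, for each
  entry of each layer and each \<open>v \<in> F\<close>, the positions at which that entry equals \<open>v\<close>. The only
  communication between positions is through averages. For a fixed query vector (one of finitely
  many), the comparison of an average of values \<open>f(p)\<close> with a rational \<open>\<theta>\<close> is the comparison of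
  \<open>\<Sum>\<^sub>v (v - \<theta>) \<cdot> #{p. f(p) = v}\<close> with 0, a linear condition on counts; and the result of rounding
  an average is determined by finitely many such comparisons, because all thresholds of the
  rounding function are rational. The positional encoding is periodic, hence expressible
  with \<open>MOD\<close>.\<close>

section \<open>Definable properties of positions\<close>

text \<open>Free count variables are excluded so that such a formula keeps its truth value under any
  rebinding of count variables. It can then be placed below the quantifiers of
  \<open>count_formula\<close> without renaming.\<close>

definition formula_over :: "nat set \<Rightarrow> 'a foc \<Rightarrow> bool" where
  "formula_over V \<phi> \<longleftrightarrow> moduli_pos \<phi> \<and> free_count \<phi> = {} \<and> free_pos \<phi> \<subseteq> V"

text \<open>Position 0, which holds CLS, is not in the range of position variables; it gets a
  sentence of its own.\<close>

definition foc_property :: "('a list \<Rightarrow> nat \<Rightarrow> bool) \<Rightarrow> bool" where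
  "foc_property P \<longleftrightarrow>
     (\<exists>\<phi>. formula_over {0} \<phi> \<and>
       (\<forall>w \<alpha> \<beta>. \<alpha> 0 \<in> {1..length w} \<longrightarrow> (sat w \<alpha> \<beta> \<phi> \<longleftrightarrow> P w (\<alpha> 0)))) \<and>
     (\<exists>\<chi>. formula_over {} \<chi> \<and> (\<forall>w \<alpha> \<beta>. sat w \<alpha> \<beta> \<chi> \<longleftrightarrow> P w 0))"

lemma foc_propertyI:
  assumes "formula_over {0} \<phi>"
    and "\<And>w \<alpha> \<beta>. \<alpha> 0 \<in> {1..length w} \<Longrightarrow> sat w \<alpha> \<beta> \<phi> \<longleftrightarrow> P w (\<alpha> 0)"
    and "formula_over {} \<chi>"
    and "\<And>w \<alpha> \<beta>. sat w \<alpha> \<beta> \<chi> \<longleftrightarrow> P w 0"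
  shows "foc_property P"
  using assms unfolding foc_property_def by blast

lemma foc_propertyE:
  assumes "foc_property P"
  obtains \<phi> \<chi> where "formula_over {0} \<phi>"
    and "\<And>w \<alpha> \<beta>. \<alpha> 0 \<in> {1..length w} \<Longrightarrow> sat w \<alpha> \<beta> \<phi> \<longleftrightarrow> P w (\<alpha> 0)"
    and "formula_over {} \<chi>"
    and "\<And>w \<alpha> \<beta>. sat w \<alpha> \<beta> \<chi> \<longleftrightarrow> P w 0"
  using assms unfolding foc_property_def by blast

text \<open>Formulas only ever speak about positions up to the length of the string, so the two
  properties may differ beyond it.\<close>

lemma foc_property_cong:
  assumes "foc_property P" "\<And>w p. p \<le> length w \<Longrightarrow> P w p \<longleftrightarrow> Q w p"
  shows "foc_property Q"
proof -
  obtain \<phi> \<chi> where "formula_over {0} \<phi>"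
    and "\<And>w \<alpha> \<beta>. \<alpha> 0 \<in> {1..length w} \<Longrightarrow> sat w \<alpha> \<beta> \<phi> \<longleftrightarrow> P w (\<alpha> 0)"
    and "formula_over {} \<chi>" and "\<And>w \<alpha> \<beta>. sat w \<alpha> \<beta> \<chi> \<longleftrightarrow> P w 0"
    using foc_propertyE[OF assms(1)] by blast
  then show ?thesis
    using assms(2) by (intro foc_propertyI[of \<phi> _ \<chi>]) auto
qed

section \<open>Boolean combinations and finite disjunctions\<close>

lemma foc_property_const: "foc_property (\<lambda>w p. b)"
  by (rule foc_propertyI[of "if b then Tru else Fls" _ "if b then Tru else Fls"])
    (auto simp: formula_over_def)

lemma foc_property_not:
  assumes "foc_property P"
  shows "foc_property (\<lambda>w p. \<not> P w p)"
proof -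
  obtain \<phi> \<chi> where "formula_over {0} \<phi>"
    and "\<And>w \<alpha> \<beta>. \<alpha> 0 \<in> {1..length w} \<Longrightarrow> sat w \<alpha> \<beta> \<phi> \<longleftrightarrow> P w (\<alpha> 0)"
    and "formula_over {} \<chi>" and "\<And>w \<alpha> \<beta>. sat w \<alpha> \<beta> \<chi> \<longleftrightarrow> P w 0"
    using foc_propertyE[OF assms] by blast
  then show ?thesis
    by (intro foc_propertyI[of "Neg \<phi>" _ "Neg \<chi>"]) (auto simp: formula_over_def)
qed

lemma foc_property_conj:
  assumes "foc_property P" "foc_property Q"
  shows "foc_property (\<lambda>w p. P w p \<and> Q w p)"
proof -
  obtain \<phi> \<chi> where P: "formula_over {0} \<phi>"
    "\<And>w \<alpha> \<beta>. \<alpha> 0 \<in> {1..length w} \<Longrightarrow> sat w \<alpha> \<beta> \<phi> \<longleftrightarrow> P w (\<alpha> 0)"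
    "formula_over {} \<chi>" "\<And>w \<alpha> \<beta>. sat w \<alpha> \<beta> \<chi> \<longleftrightarrow> P w 0"
    using foc_propertyE[OF assms(1)] by blast
  obtain \<phi>' \<chi>' where Q: "formula_over {0} \<phi>'"
    "\<And>w \<alpha> \<beta>. \<alpha> 0 \<in> {1..length w} \<Longrightarrow> sat w \<alpha> \<beta> \<phi>' \<longleftrightarrow> Q w (\<alpha> 0)"
    "formula_over {} \<chi>'" "\<And>w \<alpha> \<beta>. sat w \<alpha> \<beta> \<chi>' \<longleftrightarrow> Q w 0"
    using foc_propertyE[OF assms(2)] by blast
  show ?thesis
    using P Q by (intro foc_propertyI[of "Conj \<phi> \<phi>'" _ "Conj \<chi> \<chi>'"])
      (auto simp: formula_over_def)
qed

lemma foc_property_disj: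
  assumes "foc_property P" "foc_property Q"
  shows "foc_property (\<lambda>w p. P w p \<or> Q w p)"
  using foc_property_not[OF foc_property_conj[OF foc_property_not foc_property_not], OF assms]
  by simp

lemma foc_property_Bex:
  assumes "finite X" "\<And>u. u \<in> X \<Longrightarrow> foc_property (P u)"
  shows "foc_property (\<lambda>w p. \<exists>u\<in>X. P u w p)"
  using assms
proof (induction X rule: finite_induct)
  case empty
  then show ?case by (simp add: foc_property_const)
next
  case (insert x X)
  then show ?case using foc_property_disj[of "P x" "\<lambda>w p. \<exists>u\<in>X. P u w p"] by simp
qed

text \<open>The sentence that describes position 0 has no free position variable, so it serves for
  all other positions as well.\<close>

lemma foc_property_at_0:
  assumes "foc_property P"
  shows "foc_property (\<lambda>w p. P w 0)"
proof -
  obtain \<chi> where "formula_over {} \<chi>" "\<forall>w \<alpha> \<beta>. sat w \<alpha> \<beta> \<chi> \<longleftrightarrow> P w 0"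
    using assms unfolding foc_property_def by blast
  then show ?thesis
    by (intro foc_propertyI[of \<chi> _ \<chi>]) (auto simp: formula_over_def)
qed

lemma foc_definable_if_foc_property:
  assumes "foc_property (\<lambda>w p. w \<in> L)"
  shows "foc_definable L"
proof -
  obtain \<chi> where "formula_over {} \<chi>" "\<forall>w \<alpha> \<beta>. sat w \<alpha> \<beta> \<chi> \<longleftrightarrow> w \<in> L"
    using assms unfolding foc_property_def by blast
  then show ?thesis
    unfolding foc_definable_def sentence_def foc_language_def formula_over_def
    by (intro exI[of _ \<chi>]) auto
qed


section \<open>Definable functions with finitely many values\<close>

text \<open>Finiteness of \<open>X\<close> allows \<open>g\<close> to be described by finitely many
  formulas, one for each value. Beyond the end of the string \<open>g\<close> is
  unconstrained.\<close>

definition definable :: "'v set \<Rightarrow> ('a list \<Rightarrow> nat \<Rightarrow> 'v) \<Rightarrow> bool" where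
  "definable X g \<longleftrightarrow> finite X \<and> (\<forall>w. \<forall>p\<le>length w. g w p \<in> X) \<and>
     (\<forall>v\<in>X. foc_property (\<lambda>w p. g w p = v))"

lemma definable_mem: "definable X g \<Longrightarrow> p \<le> length w \<Longrightarrow> g w p \<in> X"
  by (simp add: definable_def)

lemma definable_const: "finite X \<Longrightarrow> c \<in> X \<Longrightarrow> definable X (\<lambda>w p. c)"
  by (simp add: definable_def foc_property_const)

text \<open>Case distinction over the finitely many values \<open>u\<close> of \<open>g\<close>.
  Definability of \<open>h u\<close> is required only for fixed \<open>u\<close>, so a value that
  varies with the position can be treated as a constant inside \<open>h\<close>.\<close>

lemma definable_bind:
  assumes g: "definable X g" and h: "\<And>u. u \<in> X \<Longrightarrow> definable Y (h u)"
    and Y: "finite Y"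
  shows "definable Y (\<lambda>w p. h (g w p) w p)"
  unfolding definable_def
proof (intro conjI ballI allI impI)
  show "h (g w p) w p \<in> Y" if "p \<le> length w" for w p
    using definable_mem[OF g that] definable_mem[OF h that] by blast
  fix v assume v: "v \<in> Y"
  have "foc_property (\<lambda>w p. \<exists>u\<in>X. g w p = u \<and> h u w p = v)"
    using g h v by (intro foc_property_Bex foc_property_conj) (auto simp: definable_def)
  then show "foc_property (\<lambda>w p. h (g w p) w p = v)"
    by (rule foc_property_cong) (use g in \<open>auto simp: definable_def\<close>)
qed (use Y in auto)

lemma definable_map:
  assumes "definable X g" "finite Y" "h \<in> X \<rightarrow> Y"
  shows "definable Y (\<lambda>w p. h (g w p))"
proof (rule definable_bind[OF assms(1) _ assms(2), where h = "\<lambda>u w p. h u"])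
  show "definable Y (\<lambda>w p. h u)" if "u \<in> X" for u
    using assms that by (intro definable_const) auto
qed

lemma definable_map2:
  assumes "definable X f" "definable Y g" "finite Z" "h \<in> X \<rightarrow> Y \<rightarrow> Z"
  shows "definable Z (\<lambda>w p. h (f w p) (g w p))"
proof (rule definable_bind[OF assms(1) _ assms(3), where h = "\<lambda>u w p. h u (g w p)"])
  show "definable Z (\<lambda>w p. h u (g w p))" if "u \<in> X" for u
    using assms that by (intro definable_map[of Y g Z "h u"]) auto
qed

text \<open>Makes a whole vector available as a single value, so that \<open>definable_bind\<close>
  can fix all its entries at once.\<close>

lemma definable_list:
  assumes "finite X" "\<And>i. i < k \<Longrightarrow> definable X (g i)"
  shows "definable {xs. set xs \<subseteq> X \<and> length xs = k} (\<lambda>w p. map (\<lambda>i. g i w p) [0..<k])"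
  using assms(2)
proof (induction k)
  case 0
  show ?case by (simp add: definable_const finite_lists_length_eq assms(1))
next
  case (Suc k)
  have "definable {xs. set xs \<subseteq> X \<and> length xs = Suc k}
      (\<lambda>w p. (\<lambda>xs x. xs @ [x]) (map (\<lambda>i. g i w p) [0..<k]) (g k w p))"
    by (rule definable_map2[of "{xs. set xs \<subseteq> X \<and> length xs = k}" _ X])
      (use Suc assms(1) in \<open>auto simp: finite_lists_length_eq\<close>)
  then show ?case by simp
qed

lemma foc_property_definable:
  assumes "definable X g"
  shows "foc_property (\<lambda>w p. Q (g w p))"
proof -
  have "foc_property (\<lambda>w p. \<exists>u\<in>X. g w p = u \<and> Q u)"
    using assms by (intro foc_property_Bex foc_property_conj foc_property_const)
      (auto simp: definable_def)
  then show ?thesis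
    by (rule foc_property_cong) (use assms in \<open>auto simp: definable_def\<close>)
qed

section \<open>Letters and residues of positions\<close>

lemma definable_letter:
  "definable UNIV (\<lambda>(w :: 'a::finite list) p. if p = 0 then None else Some (w ! (p - 1)))"
  unfolding definable_def
proof (intro conjI ballI)
  fix v :: "'a option"
  show "foc_property (\<lambda>w p. (if p = 0 then None else Some (w ! (p - 1))) = v)"
  proof (cases v)
    case None
    then show ?thesis
      \<comment> \<open>CLS stands at position 0 and nowhere else.\<close>
      by (intro foc_propertyI[of Fls _ Tru]) (auto simp: formula_over_def)
  next
    case (Some a)
    then show ?thesis
      by (intro foc_propertyI[of "Letter a 0" _ Fls]) (auto simp: formula_over_def)
  qed
qed auto

lemma definable_mod:
  assumes "m > 0"
  shows "definable {..<m} (\<lambda>w p. p mod m)"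
  unfolding definable_def
proof (intro conjI ballI)
  fix v assume "v \<in> {..<m}"
  then show "foc_property (\<lambda>w p. p mod m = v)"
    using assms
    \<comment> \<open>Position 0 has residue 0, so its sentence is a constant.\<close>
    by (intro foc_propertyI[of "Mod v m 0" _ "if v = 0 then Tru else Fls"])
      (auto simp: formula_over_def)
qed (use assms in auto)


section \<open>Sums over all positions\<close>

text \<open>The count of positions with \<open>f(p) = v\<close>, expressed by \<open>\<Phi> v\<close>, is bound to a fresh count
  variable, numbered from \<open>k\<close> on, and enters the linear combination \<open>cs\<close> with coefficient \<open>v\<close>;
  \<open>R\<close> makes the final statement about \<open>cs\<close>.\<close>

fun count_formula ::
    "((rat \<times> nat) list \<Rightarrow> 'a foc) \<Rightarrow> (rat \<Rightarrow> 'a foc) \<Rightarrow> nat \<Rightarrow> (rat \<times> nat) list \<Rightarrow> rat list \<Rightarrow> 'a foc"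
where
  "count_formula R \<Phi> k cs [] = R cs"
| "count_formula R \<Phi> k cs (v # vs) =
     ExC k (Conj (ExCount k 0 (\<Phi> v)) (count_formula R \<Phi> (Suc k) ((v, k) # cs) vs))"

lemma formula_over_count_formula:
  assumes "\<And>v. v \<in> set vs \<Longrightarrow> formula_over {0} (\<Phi> v)"
    and "\<And>cs. moduli_pos (R cs)" "\<And>cs. free_pos (R cs) = {}"
    and "\<And>cs. free_count (R cs) = snd ` set cs"
  shows "formula_over {} (count_formula R \<Phi> k [] vs)"
proof -
  \<comment> \<open>Generalised to a nonempty \<open>cs\<close>: its variables may occur free, while
    the variable \<open>k\<close> added in each round is bound at once by
    \<open>ExC k\<close>.\<close>
  have "moduli_pos (count_formula R \<Phi> k cs vs) \<and> free_pos (count_formula R \<Phi> k cs vs) = {} \<and>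
      free_count (count_formula R \<Phi> k cs vs) \<subseteq> snd ` set cs" for cs
    using assms(1)
  proof (induction vs arbitrary: k cs)
    case Nil
    then show ?case using assms by auto
  next
    case (Cons v vs)
    have "formula_over {0} (\<Phi> v)"
      using Cons.prems by simp
    then show ?case
      using Cons.IH[of "Suc k" "(v, k) # cs"] Cons.prems by (auto simp: formula_over_def)
  qed
  from this[of "[]"] show ?thesis by (auto simp: formula_over_def)
qed

text \<open>The conjunct \<open>ExCount k 0 (\<Phi> v)\<close> leaves the count itself as the only
  witness for \<open>k\<close>, so each quantifier just substitutes a count. All variables in
  \<open>cs\<close> lie below \<open>k\<close>, hence binding \<open>k\<close> does not disturb the
  counts collected before.\<close>

lemma sat_count_formula:
  assumes "\<And>v \<alpha> \<beta>. v \<in> set vs \<Longrightarrow> \<alpha> 0 \<in> {1..length w} \<Longrightarrow>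
      sat w \<alpha> \<beta> (\<Phi> v) \<longleftrightarrow> f (\<alpha> 0) = v"
    and "\<And>cs \<beta>. sat w \<alpha> \<beta> (R cs) \<longleftrightarrow> Q (\<Sum>(a, x)\<leftarrow>cs. a * \<beta> x)"
    and "\<And>a x. (a, x) \<in> set cs \<Longrightarrow> x < k"
  shows "sat w \<alpha> \<beta> (count_formula R \<Phi> k cs vs) \<longleftrightarrow>
    Q ((\<Sum>(a, x)\<leftarrow>cs. a * \<beta> x) +
       (\<Sum>v\<leftarrow>vs. v * of_nat (card {i \<in> {1..length w}. f i = v})))"
  using assms(1,3)
proof (induction vs arbitrary: k cs \<beta>)
  case Nil
  then show ?case by (simp add: assms(2))
next
  case (Cons v vs)
  let ?c = "of_nat (card {i \<in> {1..length w}. f i = v}) :: rat"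
  have count: "sat w \<alpha> \<beta>' (ExCount k 0 (\<Phi> v)) \<longleftrightarrow> ?c = \<beta>' k" for \<beta>'
  proof -
    have "sat w (\<alpha>(0 := i)) \<beta>' (\<Phi> v) \<longleftrightarrow> f i = v" if "i \<in> {1..length w}" for i
      using Cons.prems(1)[of v "\<alpha>(0 := i)" \<beta>'] that by (simp only: fun_upd_same list.set_intros)
    then have "{i \<in> {1..length w}. sat w (\<alpha>(0 := i)) \<beta>' (\<Phi> v)} = {i \<in> {1..length w}. f i = v}"
      by blast
    then show ?thesis by simp
  qed
  have old: "(\<Sum>(a, x)\<leftarrow>cs. a * (\<beta>(k := c)) x) = (\<Sum>(a, x)\<leftarrow>cs. a * \<beta> x)" for c
    using Cons.prems(2) by (intro arg_cong[where f = sum_list] map_cong) fastforce+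
  have rest: "sat w \<alpha> \<beta>' (count_formula R \<Phi> (Suc k) ((v, k) # cs) vs) \<longleftrightarrow>
      Q ((\<Sum>(a, x)\<leftarrow>(v, k) # cs. a * \<beta>' x) +
         (\<Sum>v\<leftarrow>vs. v * of_nat (card {i \<in> {1..length w}. f i = v})))" for \<beta>'
    by (rule Cons.IH) (use Cons.prems in \<open>auto simp: less_Suc_eq\<close>)
  have "sat w \<alpha> \<beta> (count_formula R \<Phi> k cs (v # vs)) \<longleftrightarrow>
      (\<exists>c. ?c = c \<and> sat w \<alpha> (\<beta>(k := c)) (count_formula R \<Phi> (Suc k) ((v, k) # cs) vs))"
    using count by (simp del: sat.simps(12))
  also have "\<dots> \<longleftrightarrow> Q ((\<Sum>(a, x)\<leftarrow>cs. a * \<beta> x) +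
       (\<Sum>v\<leftarrow>v # vs. v * of_nat (card {i \<in> {1..length w}. f i = v})))"
    unfolding rest using old by (simp add: ac_simps del: fun_upd_apply) (simp add: ac_simps)
  finally show ?case .
qed

text \<open>Grouping the positions by the value of \<open>f\<close> turns the sum into a linear
  combination of counts. \<open>ExCount\<close> does not see position 0, so the value there is
  guessed from the finite set \<open>X\<close> and enters the count term as its constant
  \<open>c\<close>.\<close>

lemma foc_property_sum:
  fixes f :: "'a list \<Rightarrow> nat \<Rightarrow> rat"
  assumes f: "definable X f"
    and R: "\<And>c cs. moduli_pos (R c cs :: 'a foc)" "\<And>c cs. free_pos (R c cs) = {}"
      "\<And>c cs. free_count (R c cs) = snd ` set cs"
      "\<And>w \<alpha> \<beta> c cs. sat w \<alpha> \<beta> (R c cs) \<longleftrightarrow> Q (c + (\<Sum>(a, x)\<leftarrow>cs. a * \<beta> x))"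
  shows "foc_property (\<lambda>w p. Q (\<Sum>i=0..length w. f w i))"
proof -
  have X: "finite X" and mem: "\<And>w i. i \<le> length w \<Longrightarrow> f w i \<in> X"
    using f by (auto simp: definable_def)
  obtain vs where vs: "set vs = X" "distinct vs"
    using finite_distinct_list[OF X] by blast
  have "\<forall>v\<in>X. \<exists>\<phi>. formula_over {0} \<phi> \<and>
      (\<forall>w \<alpha> \<beta>. \<alpha> 0 \<in> {1..length w} \<longrightarrow> (sat w \<alpha> \<beta> \<phi> \<longleftrightarrow> f w (\<alpha> 0) = v))"
    using f unfolding definable_def foc_property_def by blast
  then obtain \<Phi> where \<Phi>: "\<And>v. v \<in> X \<Longrightarrow> formula_over {0} (\<Phi> v)"
    "\<And>v w \<alpha> \<beta>. v \<in> X \<Longrightarrow> \<alpha> 0 \<in> {1..length w} \<Longrightarrow> sat w \<alpha> \<beta> (\<Phi> v) \<longleftrightarrow> f w (\<alpha> 0) = v"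
    by metis
  let ?S = "\<lambda>w. \<Sum>v\<leftarrow>vs. v * of_nat (card {i \<in> {1..length w}. f w i = v})"
  have split: "(\<Sum>i=0..length w. f w i) = f w 0 + ?S w" for w
  proof -
    have "(\<Sum>i=0..length w. f w i) = f w 0 + (\<Sum>i=1..length w. f w i)"
      by (simp add: sum.atLeast_Suc_atMost)
    also have "(\<Sum>i=1..length w. f w i) = (\<Sum>v\<in>X. \<Sum>i\<in>{i \<in> {1..length w}. f w i = v}. f w i)"
      using X mem by (intro sum.group[symmetric]) auto
    also have "\<dots> = (\<Sum>v\<in>X. v * of_nat (card {i \<in> {1..length w}. f w i = v}))"
      by (intro sum.cong) (auto simp: mult.commute)
    finally show ?thesis
      using vs by (simp add: sum_list_distinct_conv_sum_set)
  qed
  have Q: "foc_property (\<lambda>w p. Q (c + ?S w))" for c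
  proof (rule foc_propertyI)
    let ?\<chi> = "count_formula (R c) \<Phi> 0 [] vs"
    show over: "formula_over {} ?\<chi>"
      by (rule formula_over_count_formula) (use vs \<Phi> R in auto)
    then show "formula_over {0} ?\<chi>" by (auto simp: formula_over_def)
    show sat: "sat w \<alpha> \<beta> ?\<chi> \<longleftrightarrow> Q (c + ?S w)" for w \<alpha> \<beta>
      using sat_count_formula[of vs w \<Phi> "f w" \<alpha> "R c" "\<lambda>x. Q (c + x)" "[]" 0 \<beta>] vs \<Phi> R(4)
      by auto
    show "sat w \<alpha> \<beta> ?\<chi> \<longleftrightarrow> Q (c + ?S w)" for w \<alpha> \<beta>
      by (rule sat)
  qed
  have "foc_property (\<lambda>w p. \<exists>c\<in>X. f w 0 = c \<and> Q (c + ?S w))"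
    using X Q f foc_property_at_0[of "\<lambda>w p. f w p = c" for c]
    by (intro foc_property_Bex foc_property_conj) (auto simp: definable_def)
  then show ?thesis
    by (rule foc_property_cong) (use mem in \<open>auto simp: split\<close>)
qed

lemma foc_property_sum_less_0:
  fixes f :: "'a list \<Rightarrow> nat \<Rightarrow> rat"
  assumes "definable X f"
  shows "foc_property (\<lambda>w p. (\<Sum>i=0..length w. f w i) < 0)"
  by (rule foc_property_sum[OF assms, where R = "\<lambda>c cs. CLess (CTerm c cs) (CTerm 0 [])"]) auto

lemma foc_property_sum_eq_0:
  fixes f :: "'a list \<Rightarrow> nat \<Rightarrow> rat"
  assumes "definable X f"
  shows "foc_property (\<lambda>w p. (\<Sum>i=0..length w. f w i) = 0)"
  by (rule foc_property_sum[OF assms, where R = "\<lambda>c cs. CEq (CTerm c cs) (CTerm 0 [])"]) auto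


section \<open>Rounded averages\<close>

text \<open>The value of the rounding function at the threshold itself is left open, since ties may
  be broken in any way.\<close>

lemma rounding_threshold:
  assumes F: "finite F" "F \<subseteq> \<rat>" "c \<in> F"
    and f: "rounds_down F f \<or> rounds_up F f \<or> rounds_nearest F f"
  obtains \<theta> where "\<theta> \<in> \<rat>"
    and "\<And>x. x \<in> {Min F..Max F} \<Longrightarrow> x < \<theta> \<Longrightarrow> f x < c"
    and "\<And>x. x \<in> {Min F..Max F} \<Longrightarrow> \<theta> < x \<Longrightarrow> c \<le> f x"
proof -
  have "Min F \<in> F" "Min F \<le> c"
    using F by (auto intro: Min_in)
  then have "c = Min F \<or> (\<exists>b\<in>F. b < c)"
    by (metis order.not_eq_order_implies_strict)
  \<comment> \<open>The least element is treated apart because the thresholds for rounding up and to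
    nearest are built from the predecessor of \<open>c\<close> in \<open>F\<close>.\<close>
  then consider (Min) "c = Min F" | (down) "rounds_down F f"
    | (pred) "\<exists>b\<in>F. b < c" "rounds_up F f \<or> rounds_nearest F f"
    using f by blast
  then show thesis
  proof cases
    case Min
    have f: "f x \<in> F" if "x \<in> {Min F..Max F}" for x
      using f that unfolding rounds_down_def rounds_up_def rounds_nearest_def by blast
    show thesis
    \<comment> \<open>No admissible \<open>x\<close> lies below the minimum, and every rounded value
      is at least the minimum.\<close>
    proof (rule that[of c])
      show "f x < c" if "x \<in> {Min F..Max F}" "x < c" for x
        using that Min by simp
      show "c \<le> f x" if "x \<in> {Min F..Max F}" "c < x" for x
        unfolding Min using F(1) f[OF that(1)] by (rule Min_le)
    qed (use F in auto)
  next
    case down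
    then have f: "f x \<le> x" "\<And>y. y \<in> F \<Longrightarrow> y \<le> x \<Longrightarrow> y \<le> f x" if "x \<in> {Min F..Max F}" for x
      using that unfolding rounds_down_def by blast+
    show thesis
    proof (rule that[of c])
      show "f x < c" if "x \<in> {Min F..Max F}" "x < c" for x
        using f(1)[OF that(1)] that(2) by simp
      show "c \<le> f x" if "x \<in> {Min F..Max F}" "c < x" for x
        using f(2)[OF that(1) F(3)] that(2) by simp
    qed (use F in auto)
  next
    case pred
    \<comment> \<open>The predecessor of \<open>c\<close> in \<open>F\<close>: a rounded value is
      either at least \<open>c\<close> or at most \<open>b\<close>.\<close>
    define b where "b = Max {y \<in> F. y < c}"
    have "b \<in> {y \<in> F. y < c}"
      unfolding b_def using pred F(1) by (intro Max_in) auto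
    then have b: "b \<in> F" "b < c" by auto
    have below: "y \<le> b" if "y \<in> F" "y < c" for y
      unfolding b_def using that F(1) by (intro Max_ge) auto
    from pred(2) show thesis
    proof
      assume "rounds_up F f"
      then have f: "f x \<in> F" "x \<le> f x" "\<And>y. y \<in> F \<Longrightarrow> x \<le> y \<Longrightarrow> f x \<le> y"
        if "x \<in> {Min F..Max F}" for x
        using that unfolding rounds_up_def by blast+
      show thesis
      \<comment> \<open>Rounding up yields at most \<open>b\<close> as long as \<open>x\<close> does
        not exceed \<open>b\<close>, and jumps to \<open>c\<close> or more right after it.\<close>
      proof (rule that[of b])
        show "f x < c" if "x \<in> {Min F..Max F}" "x < b" for x
          using f(3)[OF that(1) b(1)] that(2) b(2) by simp
        show "c \<le> f x" if "x \<in> {Min F..Max F}" "b < x" for x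
          using f(1,2)[OF that(1)] that(2) below[of "f x"] by linarith
      qed (use F b in auto)
    next
      assume near: "rounds_nearest F f"
      have f: "f x \<in> F" "\<bar>x - f x\<bar> \<le> \<bar>x - b\<bar>" "\<bar>x - f x\<bar> \<le> \<bar>x - c\<bar>" for x
        using near b F(3) unfolding rounds_nearest_def by auto
      show thesis
      \<comment> \<open>The midpoint of two neighbours separates the points closer to
        \<open>b\<close> from those closer to \<open>c\<close>.\<close>
      proof (rule that[of "(b + c) / 2"])
        show "(b + c) / 2 \<in> \<rat>"
          using b F by (intro Rats_divide Rats_add) auto
        show "f x < c" if "x < (b + c) / 2" for x
          using f(2)[of x] that b by (auto simp: abs_if split: if_splits)
        show "c \<le> f x" if "(b + c) / 2 < x" for x
        proof (rule ccontr)
          assume "\<not> c \<le> f x"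
          then have "f x \<le> b" using below f(1) by simp
          then show False
            using f(3)[of x] that b by (auto simp: abs_if split: if_splits)
        qed
      qed
    qed
  qed
qed

text \<open>Needed because rounding down and rounding up are specified only between the extreme
  elements of \<open>F\<close>.\<close>

lemma average_mem:
  fixes f :: "nat \<Rightarrow> real"
  assumes F: "finite F" and f: "\<And>i. i \<le> n \<Longrightarrow> f i \<in> F"
  shows "(\<Sum>i=0..n. f i) / real (n + 1) \<in> {Min F..Max F}"
proof -
  have bounds: "Min F \<le> f i" "f i \<le> Max F" if "i \<in> {0..n}" for i
    using that F f[of i] by auto
  have "of_nat (card {0..n}) * Min F \<le> (\<Sum>i=0..n. f i)"
    by (rule sum_bounded_below) (rule bounds)
  moreover have "(\<Sum>i=0..n. f i) \<le> of_nat (card {0..n}) * Max F"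
    by (rule sum_bounded_above) (rule bounds)
  ultimately show ?thesis by (simp add: field_simps)
qed

text \<open>Subtracting the threshold \<open>\<theta>\<close> from every summand absorbs the
  division by the number of positions, so that comparing the average with \<open>\<theta>\<close>
  becomes a question about the sign of a sum.\<close>

lemma definable_average:
  fixes f :: "'a list \<Rightarrow> nat \<Rightarrow> real"
  assumes f: "definable F f" and F: "F \<subseteq> \<rat>"
    and r: "rounds_down F r \<or> rounds_up F r \<or> rounds_nearest F r"
  shows "definable F (\<lambda>w p. r ((\<Sum>i=0..length w. f w i) / real (length w + 1)))"
proof -
  define avg where "avg = (\<lambda>w. (\<Sum>i=0..length w. f w i) / real (length w + 1))"
  have fin: "finite F" using f by (simp add: definable_def)
  have avg: "avg w \<in> {Min F..Max F}" for w
    unfolding avg_def using fin definable_mem[OF f] by (intro average_mem) auto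
  have r_avg: "r (avg w) \<in> F" for w
    using r avg[of w] unfolding rounds_down_def rounds_up_def rounds_nearest_def by blast
  have ge: "foc_property (\<lambda>w p. c \<le> r (avg w))" if c: "c \<in> F" for c
  proof -
    obtain \<theta> where \<theta>: "\<theta> \<in> \<rat>"
      and below: "\<And>x. x \<in> {Min F..Max F} \<Longrightarrow> x < \<theta> \<Longrightarrow> r x < c"
      and above: "\<And>x. x \<in> {Min F..Max F} \<Longrightarrow> \<theta> < x \<Longrightarrow> c \<le> r x"
      using rounding_threshold[OF fin F c r] by blast
    \<comment> \<open>Count terms have coefficients of type \<open>rat\<close>, so the shifted
      values are pulled back along \<open>of_rat\<close>; they are rational because \<open>F\<close>
      and \<open>\<theta>\<close> are.\<close>
    define q where "q = (\<lambda>x. inv of_rat (x - \<theta>) :: rat)"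
    have q: "of_rat (q x) = x - \<theta>" if "x \<in> F" for x
    proof -
      have "x - \<theta> \<in> range of_rat"
        using that F \<theta> unfolding Rats_def[symmetric] by (intro Rats_diff) auto
      then show ?thesis unfolding q_def by (rule f_inv_into_f)
    qed
    have def_q: "definable (q ` F) (\<lambda>w p. q (f w p))"
      by (rule definable_map[OF f]) (use fin in auto)
    have sum_q: "of_rat (\<Sum>i=0..length w. q (f w i)) = (avg w - \<theta>) * real (length w + 1)" for w
    proof -
      have "of_rat (\<Sum>i=0..length w. q (f w i)) = (\<Sum>i=0..length w. f w i - \<theta>)"
        using q definable_mem[OF f] by (auto simp: of_rat_sum intro!: sum.cong)
      moreover have "(\<Sum>i=0..length w. f w i) = avg w * real (length w + 1)"
        by (simp add: avg_def)
      ultimately show ?thesis by (simp add: sum_subtractf algebra_simps)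
    qed
    have less: "(\<Sum>i=0..length w. q (f w i)) < 0 \<longleftrightarrow> avg w < \<theta>" for w
    proof -
      have "(\<Sum>i=0..length w. q (f w i)) < 0 \<longleftrightarrow> (avg w - \<theta>) * real (length w + 1) < 0"
        unfolding sum_q[symmetric] by simp
      then show ?thesis by (simp add: mult_less_0_iff)
    qed
    have eq: "(\<Sum>i=0..length w. q (f w i)) = 0 \<longleftrightarrow> avg w = \<theta>" for w
    proof -
      have "(\<Sum>i=0..length w. q (f w i)) = 0 \<longleftrightarrow> (avg w - \<theta>) * real (length w + 1) = 0"
        unfolding sum_q[symmetric] by simp
      then show ?thesis by simp
    qed
    \<comment> \<open>If the average hits \<open>\<theta>\<close> exactly, the answer is the truth
      value of \<open>c \<le> r \<theta>\<close>, which does not depend on the string.\<close>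
    have "foc_property (\<lambda>w p. \<not> (\<Sum>i=0..length w. q (f w i)) < 0 \<and>
        (\<not> (\<Sum>i=0..length w. q (f w i)) = 0 \<or> c \<le> r \<theta>))"
      by (intro foc_property_conj foc_property_disj foc_property_not foc_property_const
          foc_property_sum_less_0[OF def_q] foc_property_sum_eq_0[OF def_q])
    then show ?thesis
    proof (rule foc_property_cong)
      show "(\<not> (\<Sum>i=0..length w. q (f w i)) < 0 \<and>
          (\<not> (\<Sum>i=0..length w. q (f w i)) = 0 \<or> c \<le> r \<theta>)) \<longleftrightarrow> c \<le> r (avg w)" for w
        unfolding less eq using below[OF avg[of w]] above[OF avg[of w]]
        by (cases "avg w" \<theta> rule: linorder_cases) auto
    qed
  qed
  have "foc_property (\<lambda>w p. r (avg w) = v)" if "v \<in> F" for v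
  proof -
    \<comment> \<open>The rounded average lies in \<open>F\<close>, so it is the largest element of
      \<open>F\<close> that passes the test \<open>ge\<close>.\<close>
    have "foc_property (\<lambda>w p. v \<le> r (avg w) \<and> \<not> (\<exists>c\<in>F. v < c \<and> c \<le> r (avg w)))"
      by (intro foc_property_conj foc_property_not foc_property_Bex foc_property_const
          ge that fin) assumption
    then show ?thesis
    proof (rule foc_property_cong)
      show "(v \<le> r (avg w) \<and> \<not> (\<exists>c\<in>F. v < c \<and> c \<le> r (avg w))) \<longleftrightarrow> r (avg w) = v" for w
        using r_avg[of w]
        by (metis order.refl order.not_eq_order_implies_strict order.strict_iff_not
            order_less_le_trans)
    qed
  qed
  then show ?thesis
    using fin r_avg by (simp add: definable_def avg_def)
qed


section \<open>Transformers\<close>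

lemma fixed_points_eq:
  "fixed_points r s = (\<lambda>i. real_of_int i / 2 ^ s) ` {- (2 ^ (r + s))..<2 ^ (r + s)}"
  unfolding fixed_points_def by auto

lemma finite_fixed_points: "finite (fixed_points r s)"
  by (simp add: fixed_points_eq)

lemma fixed_points_subset_Rats: "fixed_points r s \<subseteq> \<rat>"
  by (auto simp: fixed_points_eq)

lemma zero_in_fixed_points: "0 \<in> fixed_points r s"
  unfolding fixed_points_eq by (rule image_eqI[of _ _ 0]) auto

text \<open>For a frequency \<open>a / b\<close> in lowest terms, a shift of the position by
  \<open>b\<close> changes the angle by \<open>a\<close> full turns, so the denominator is a
  period.\<close>

lemma pos_enc_periodic:
  obtains m where "m > 0" "\<And>p. pos_enc \<xi> p i = pos_enc \<xi> (p mod m) i"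
proof -
  obtain a b where ab: "quotient_of (\<xi> (i div 2)) = (a, b)" by fastforce
  have b: "b > 0" using quotient_of_denom_pos[OF ab] .
  have \<xi>: "of_rat (\<xi> (i div 2)) = real_of_int a / real_of_int b"
    by (simp add: quotient_of_div[OF ab] of_rat_divide)
  show thesis
  proof (rule that)
    show "nat b > 0" using b by simp
    fix p
    let ?x = "\<lambda>p. 2 * pi * of_rat (\<xi> (i div 2)) * real p"
    have "real p = real (nat b) * real (p div nat b) + real (p mod nat b)"
      by (metis mult_div_mod_eq of_nat_add of_nat_mult)
    then have "?x p = ?x (p mod nat b) + 2 * pi * of_int (a * int (p div nat b))"
      using b by (simp add: \<xi> field_simps)
    then have "sin (?x p) = sin (?x (p mod nat b))" "cos (?x p) = cos (?x (p mod nat b))"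
      by (simp_all only: sin_add cos_add sin_int_2pin cos_int_2pin)
    then show "pos_enc \<xi> p i = pos_enc \<xi> (p mod nat b) i"
      unfolding pos_enc_def Let_def by simp
  qed
qed

section \<open>Evaluation of a transformer in fixed precision\<close>

lemma fp_sum_cong:
  "(\<And>j. j \<in> set (summands t) \<Longrightarrow> f j = g j) \<Longrightarrow> fp_sum ar t f = fp_sum ar t g"
proof (induction t)
  case (Plus t u)
  then have "fp_sum ar t f = fp_sum ar t g" "fp_sum ar u f = fp_sum ar u g" by auto
  then show ?case by simp
qed auto

text \<open>Finiteness bounds the number of activation values, rationality makes thresholds of
  averages expressible in count terms, and 0 is the value of an empty sum.\<close>

locale fixed_precision =
  fixes F :: "real set" and ar :: arith
  assumes arith: "fp_arith F ar"
    and finite_F: "finite F" and F_Rats: "F \<subseteq> \<rat>" and zero_F: "0 \<in> F"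
begin

lemma op_closed:
  "op_add ar \<in> F \<rightarrow> F \<rightarrow> F" "op_mult ar \<in> F \<rightarrow> F \<rightarrow> F" "op_div ar \<in> F \<rightarrow> F \<rightarrow> F"
  "op_exp ar \<in> F \<rightarrow> F" "op_relu ar \<in> F \<rightarrow> F" "op_sigmoid ar \<in> F \<rightarrow> F" "op_scale ar \<in> F \<rightarrow> F"
  using arith by (simp_all add: fp_arith_def)

lemma definable_op:
  assumes "definable F f"
  shows "definable F (\<lambda>w p. op_exp ar (f w p))" "definable F (\<lambda>w p. op_relu ar (f w p))"
    "definable F (\<lambda>w p. op_sigmoid ar (f w p))" "definable F (\<lambda>w p. op_scale ar (f w p))"
  by (fact definable_map[OF assms finite_F op_closed(4)] definable_map[OF assms finite_F op_closed(5)]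
      definable_map[OF assms finite_F op_closed(6)] definable_map[OF assms finite_F op_closed(7)])+

lemma definable_op2:
  assumes "definable F f" "definable F g"
  shows "definable F (\<lambda>w p. op_add ar (f w p) (g w p))"
    "definable F (\<lambda>w p. op_mult ar (f w p) (g w p))"
    "definable F (\<lambda>w p. op_div ar (f w p) (g w p))"
  by (fact definable_map2[OF assms finite_F op_closed(1)]
      definable_map2[OF assms finite_F op_closed(2)] definable_map2[OF assms finite_F op_closed(3)])+

lemma definable_fp_sum:
  assumes "\<And>j. j \<in> set (summands t) \<Longrightarrow> definable F (\<lambda>w p. f w p j)"
  shows "definable F (\<lambda>w p. fp_sum ar t (f w p))"
  using assms
proof (induction t)
  case Zero
  then show ?case by (simp add: definable_const finite_F zero_F)
next
  case (Plus t u)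
  then show ?case by (simp add: definable_op2)
qed simp

lemma definable_linear_app:
  assumes "fp_linear F m n M" "i < m" "\<And>j. j < n \<Longrightarrow> definable F (\<lambda>w p. v w p j)"
  shows "definable F (\<lambda>w p. linear_app ar M (v w p) i)"
  unfolding linear_app_def
  using assms
  by (intro definable_fp_sum definable_op2 definable_const finite_F)
    (auto simp: fp_linear_def orders_def)

lemma definable_affine_app:
  assumes "fp_affine F m n M" "i < m" "\<And>j. j < n \<Longrightarrow> definable F (\<lambda>w p. v w p j)"
  shows "definable F (\<lambda>w p. affine_app ar M (v w p) i)"
  unfolding affine_app_def
proof (rule definable_fp_sum)
  fix j assume "j \<in> set (summands (row_order M i))"
  then have "j < Suc n" using assms by (auto simp: fp_affine_def orders_def)
  then show "definable F (\<lambda>w p. case j of 0 \<Rightarrow> bias M i |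
      Suc j \<Rightarrow> op_mult ar (weight M i j) (v w p j))"
    using assms
    by (cases j) (auto intro!: definable_op2 definable_const finite_F simp: fp_affine_def)
qed

lemma definable_fp_average:
  assumes "definable F f"
  shows "definable F (\<lambda>w p. fp_average ar (length w) (f w))"
  unfolding fp_average_def
  by (rule definable_average[OF assms F_Rats]) (use arith in \<open>simp add: fp_arith_def\<close>)

text \<open>Position \<open>q\<close> enters the attention only through its query vector, so one can fix the value
  of that vector first and quantify over its finitely many values.\<close>

lemma definable_attention:
  assumes h: "fp_head F d h" and i: "i < d"
    and A: "\<And>j. j < d \<Longrightarrow> definable F (\<lambda>w p. A w p j)"
  shows "definable F (\<lambda>w q. attention ar (length w) h (A w) q i)"
proof -
  let ?k = "key_width h"
  define U where "U = {us. set us \<subseteq> F \<and> length us = ?k}"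
  define query where "query = (\<lambda>w q. map (\<lambda>j. linear_app ar (WQ h) (A w q) j) [0..<?k])"
  \<comment> \<open>The score with the query vector as a parameter \<open>us\<close>: position
    \<open>q\<close> no longer occurs.\<close>
  define sc where "sc = (\<lambda>us w p. op_scale ar (fp_sum ar (score_order h)
    (\<lambda>j. op_mult ar (us ! j) (linear_app ar (WK h) (A w p) j))))"
  have order: "set (summands (score_order h)) = {..<?k}"
    using h by (simp add: fp_head_def orders_def)
  have query: "definable U query"
    unfolding U_def query_def
    using h A by (intro definable_list finite_F definable_linear_app[of ?k d])
      (auto simp: fp_head_def)
  have sc: "definable F (sc us)" if "us \<in> U" for us
    unfolding sc_def
  proof (intro definable_op definable_fp_sum definable_op2)
    fix j assume "j \<in> set (summands (score_order h))"
    then have j: "j < ?k" by (simp add: order)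
    then have "us ! j \<in> F" using that by (auto simp: U_def)
    then show "definable F (\<lambda>w p. us ! j)" by (rule definable_const[OF finite_F])
    show "definable F (\<lambda>w p. linear_app ar (WK h) (A w p) j)"
      using h A j by (intro definable_linear_app[of ?k d]) (auto simp: fp_head_def)
  qed
  have score: "score ar h (A w) q p = sc (query w q) w p" for w q p
    unfolding score_def sc_def query_def
    \<comment> \<open>The list \<open>query w q\<close> has entries only below the key width, and
      \<open>score_order\<close> refers to no others.\<close>
    by (rule arg_cong[where f = "op_scale ar"], rule fp_sum_cong) (simp add: order)
  have V: "definable F (\<lambda>w p. linear_app ar (WV h) (A w p) i)"
    using h A i by (intro definable_linear_app[of d d]) (auto simp: fp_head_def)
  \<comment> \<open>For fixed \<open>us\<close> the output depends on the string alone, so both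
    averages are covered by \<open>definable_fp_average\<close>. The actual query vector is put in
    afterwards by \<open>definable_bind\<close>.\<close>
  define out where "out = (\<lambda>us w (q :: nat). op_div ar
    (fp_average ar (length w)
      (\<lambda>p. op_mult ar (op_exp ar (sc us w p)) (linear_app ar (WV h) (A w p) i)))
    (fp_average ar (length w) (\<lambda>p. op_exp ar (sc us w p))))"
  have "definable F (out us)" if "us \<in> U" for us
    unfolding out_def
    by (rule definable_op2 definable_op definable_fp_average sc[OF that] V)+
  then have "definable F (\<lambda>w q. out (query w q) w q)"
    using finite_F by (rule definable_bind[OF query])
  then show ?thesis
    unfolding out_def attention_def score .
qed

lemma definable_heads_app:
  assumes l: "fp_layer F d l" and i: "i < d"
    and A: "\<And>j. j < d \<Longrightarrow> definable F (\<lambda>w p. A w p j)"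
  shows "definable F (\<lambda>w q. heads_app ar (length w) l (A w) q i)"
  unfolding heads_app_def
proof (rule definable_fp_sum)
  fix j assume "j \<in> set (summands (heads_order l i))"
  then have "j < Suc (length (heads l))" using l i by (auto simp: fp_layer_def orders_def)
  then show "definable F (\<lambda>w q. case j of 0 \<Rightarrow> A w q i |
      Suc k \<Rightarrow> attention ar (length w) (heads l ! k) (A w) q i)"
    using l i A by (cases j) (auto intro!: definable_attention[of d] simp: fp_layer_def)
qed

lemma definable_layer_app:
  assumes l: "fp_layer F d l" and i: "i < d"
    and A: "\<And>j. j < d \<Longrightarrow> definable F (\<lambda>w p. A w p j)"
  shows "definable F (\<lambda>w q. layer_app ar (length w) l (A w) q i)"
proof -
  have ff: "fp_affine F (hidden_width l) d (ff1 l)" "fp_affine F d (hidden_width l) (ff2 l)"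
    using l by (simp_all add: fp_layer_def)
  have H: "definable F (\<lambda>w q. heads_app ar (length w) l (A w) q j)" if "j < d" for j
    using l that A by (rule definable_heads_app)
  have ff1: "definable F (\<lambda>w q. affine_app ar (ff1 l) (heads_app ar (length w) l (A w) q) k)"
    if "k < hidden_width l" for k
    using ff(1) that H by (rule definable_affine_app)
  have "definable F (\<lambda>w q. ff_app ar l (heads_app ar (length w) l (A w) q) i)"
    unfolding ff_app_def
    using ff(2) i definable_op(2)[OF ff1] by (rule definable_affine_app)
  then show ?thesis
    unfolding layer_app_def Let_def using H[OF i] by (rule definable_op2)
qed

lemma definable_fold_layer_app:
  assumes "\<forall>l\<in>set ls. fp_layer F d l" "\<And>j. j < d \<Longrightarrow> definable F (\<lambda>w p. A w p j)" "i < d"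
  shows "definable F (\<lambda>w p. fold (layer_app ar (length w)) ls (A w) p i)"
  using assms
proof (induction ls arbitrary: A)
  case (Cons l ls)
  have "definable F (\<lambda>w p. fold (layer_app ar (length w)) ls
      (layer_app ar (length w) l (A w)) p i)"
    using Cons.prems
    by (intro Cons.IH[of "\<lambda>w. layer_app ar (length w) l (A w)"] definable_layer_app[of d]) auto
  then show ?case by simp
qed simp

text \<open>The rounded positional encoding is a function of the residue of the position modulo a
  period, and the word embedding is a function of the letter; both arguments range over finite
  sets.\<close>

lemma definable_embed:
  fixes T :: "'a::finite classifier"
  assumes T: "fp_classifier F T" and i: "i < width T"
  shows "definable F (\<lambda>w p. embed ar T w p i)"
proof -
  obtain m where m: "m > 0" "\<And>p. pos_enc (freq T) p i = pos_enc (freq T) (p mod m) i"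
    using pos_enc_periodic[of "freq T" i] by blast
  have "pe_round ar x \<in> F" for x
    using arith by (simp add: fp_arith_def rounds_nearest_def)
  then have "definable F (\<lambda>w p. pe_round ar (pos_enc (freq T) (p mod m) i))"
    using finite_F
    by (intro definable_map[OF definable_mod[OF m(1)],
          where h = "\<lambda>p. pe_round ar (pos_enc (freq T) p i)"]) auto
  then have pe: "definable F (\<lambda>w p. pe_round ar (pos_enc (freq T) p i))"
    unfolding m(2)[symmetric] .
  have "definable F (\<lambda>w p. word_emb T (if p = 0 then None else Some (w ! (p - 1))) i)"
    using T i finite_F
    by (intro definable_map[OF definable_letter, where h = "\<lambda>a. word_emb T a i"])
      (auto simp: fp_classifier_def)
  then show ?thesis
    unfolding embed_def using pe by (rule definable_op2)
qed

text \<open>The output map is shown definable at every position. Acceptance is read off at position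
  0, where definability provides a sentence.\<close>

lemma foc_definable_recognized_language:
  fixes T :: "'a::finite classifier"
  assumes T: "fp_classifier F T"
  shows "foc_definable (recognized_language ar T)"
proof -
  have enc: "definable F (\<lambda>w p. encode ar T w p i)" if "i < width T" for i
    unfolding encode_def using T that
    by (intro definable_fold_layer_app[of _ "width T"] definable_embed)
      (auto simp: fp_classifier_def)
  have "definable F (\<lambda>w p. op_sigmoid ar (affine_app ar (out T) (encode ar T w p) 0))"
    using T enc by (intro definable_op definable_affine_app[of 1 "width T"])
      (auto simp: fp_classifier_def)
  from foc_property_at_0[OF foc_property_definable[OF this, of "\<lambda>x. x \<ge> 1 / 2"]]
  show ?thesis
    by (intro foc_definable_if_foc_property) (simp add: recognized_language_def classify_def)
qed

end

theorem theorem2: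
  fixes L :: "'a::finite list set"
  assumes "fp_recognizable L"
  shows "foc_definable L"
proof -
  obtain r s ar and T :: "'a classifier" where
    ar: "fp_arith (fixed_points r s) ar" and T: "fp_classifier (fixed_points r s) T"
    and L: "recognized_language ar T = L"
    using assms unfolding fp_recognizable_def by blast
  interpret fixed_precision "fixed_points r s" ar
    by unfold_locales
      (use ar finite_fixed_points fixed_points_subset_Rats zero_in_fixed_points in auto)
  show ?thesis
    using foc_definable_recognized_language[OF T] L by simp
qed

end
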